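(* Let $n>2$ be an integer. Then the ring $\mathbb{T}_n(\mathbb{F}_2)$ is almost $n$-torsion clean if and only if $n=2^l$ for some integer $l\geq 2$.
   Context: $\mathbb{F}_2$ is the field with two elements and $\mathbb{T}_n(\mathbb{F}_2)$ is the ring of all upper triangular $n\times n$ matrices over $\mathbb{F}_2$. For a positive integer $m$, a ring $R$ with identity $1\neq 0$ is called almost $m$-torsion clean if for every $r\in R$ there exist a unit $u\in R$ with $u^m=1$ and an idempotent $e\in R$ (i.e. $e^2=e$) such that $r=u+e$. *)

theory Defs
  imports
    "Jordan_Normal_Form.Matrix"
    "HOL-Library.Z2"
    "HOL-Algebra.Subrings"
begin

definition ut_ring :: "'a::comm_ring_1 itself \<Rightarrow> nat \<Rightarrow> 'a mat ring" where
  "ut_ring ty n =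
     (ring_mat ty n ())\<lparr>carrier := {A \<in> carrier_mat n n. upper_triangular A}\<rparr>"

definition almost_torsion_clean :: "nat \<Rightarrow> ('a, 'b) ring_scheme \<Rightarrow> bool" where
  "almost_torsion_clean m R \<longleftrightarrow>
     0 < m \<and> ring R \<and> \<one>\<^bsub>R\<^esub> \<noteq> \<zero>\<^bsub>R\<^esub> \<and>
     (\<forall>r \<in> carrier R. \<exists>u \<in> Units R. \<exists>e \<in> carrier R.
        u [^]\<^bsub>R\<^esub> m = \<one>\<^bsub>R\<^esub> \<and> e \<otimes>\<^bsub>R\<^esub> e = e \<and> r = u \<oplus>\<^bsub>R\<^esub> e)"

lemma ring_ut_ring: "ring (ut_ring TYPE('a::comm_ring_1) n)"
proof -
  let ?M = "ring_mat TYPE('a) n ()"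
  let ?H = "{A \<in> carrier_mat n n. upper_triangular (A :: 'a mat)}"
  interpret ring ?M by (rule ring_mat)
  have uminus: "\<ominus>\<^bsub>?M\<^esub> A = - A" if "A \<in> carrier_mat n n" for A :: "'a mat"
    by (rule minus_equality)
      (use that in \<open>auto simp: ring_mat_simps intro: uminus_l_inv_mat\<close>)
  have mult: "upper_triangular (A * B)"
    if A: "A \<in> carrier_mat n n" "upper_triangular A"
      and B: "B \<in> carrier_mat n n" "upper_triangular B" for A B :: "'a mat"
  proof (rule upper_triangularI)
    fix i j assume ij: "j < i" "i < dim_row (A * B)"
    have "A $$ (i, k) * B $$ (k, j) = 0" if "k < n" for k
      using A(1) B(1) ij that upper_triangularD[OF A(2), of k i] upper_triangularD[OF B(2), of j k]
      by (cases "k < i") auto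
    then show "(A * B) $$ (i, j) = 0"
      using A(1) B(1) ij by (auto simp: scalar_prod_def intro!: sum.neutral)
  qed
  have "upper_triangular (- A)" "upper_triangular (A + B)"
    if "A \<in> carrier_mat n n" "upper_triangular A"
      and "B \<in> carrier_mat n n" "upper_triangular B" for A B :: "'a mat"
    using that by (auto simp: upper_triangular_def)
  then have "subring ?H ?M"
    by (intro subringI) (auto simp: ring_mat_simps uminus mult)
  from subring_is_ring[OF this] show ?thesis
    by (simp add: ut_ring_def)
qed

lemma ut_ring_one_neq_zero:
  "0 < n \<Longrightarrow> \<one>\<^bsub>ut_ring TYPE('a::comm_ring_1) n\<^esub> \<noteq> \<zero>\<^bsub>ut_ring TYPE('a) n\<^esub>"
  by (auto simp: ut_ring_def ring_mat_simps dest: arg_cong[where f = "\<lambda>A. A $$ (0, 0)"])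

end

theory Submission
  imports Defs
begin

text \<open>
  Over \<open>\<F>\<^sub>2\<close> a unit of the ring of upper triangular matrices has only ones on the diagonal, so it is
  unipotent, and its order is a power of two.

  If \<open>n\<close> is a power of two, every unipotent \<open>u = 1 + B\<close> satisfies \<open>u ^ n = 1 + B ^ n = 1\<close>, so the
  torsion condition costs nothing and it suffices that each \<open>r\<close> is the sum of a unit and an
  idempotent: a diagonal \<open>0/1\<close> matrix is idempotent, and subtracting the one with diagonal
  \<open>1 + r\<^sub>i\<^sub>i\<close> from \<open>r\<close> leaves a unitriangular matrix.

  Conversely, let \<open>r\<close> be the nilpotent Jordan block.  In \<open>r = u + e\<close> the idempotent \<open>e\<close> must have
  diagonal \<open>1\<close>; a unipotent idempotent is \<open>1\<close> (\<open>idempotent_unitriangular_eq_one\<close>), so \<open>u = 1 + r\<close>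
  is forced.  The first row of \<open>(1 + r) ^ n\<close> consists of the binomial coefficients
  \<open>n choose j\<close> modulo 2 (\<open>first_row_pow_one_plus_jordan\<close>), so \<open>u ^ n = 1\<close> says that all inner
  entries of the \<open>n\<close>-th row of Pascal's triangle are even, which happens only for powers of two
  (\<open>power_of_two_if_inner_binomials_even\<close>).
\<close>

section \<open>Parity of binomial coefficients\<close>

text \<open>
  This is \<open>(1 + X) ^ (2 * m) = (1 + X\<^sup>2) ^ m\<close> modulo 2, read off coefficientwise.  Both parity
  classes of the lower index are needed at once for the induction on \<open>m\<close>.
\<close>
lemma binomial_double_parity:
  "even ((2 * m) choose (2 * j)) \<longleftrightarrow> even (m choose j)"
  "even ((2 * m) choose (2 * j + 1))"
proof -
  have "(\<forall>j. even ((2 * m) choose (2 * j)) \<longleftrightarrow> even (m choose j)) \<and>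
        (\<forall>j. even ((2 * m) choose (2 * j + 1)))"
  proof (induction m)
    case 0
    have "(0 choose (2 * j)) = (0 choose j)" for j :: nat by (cases j) simp_all
    then show ?case by simp
  next
    case (Suc m)
    then have IH: "even ((2 * m) choose (2 * j)) \<longleftrightarrow> even (m choose j)"
      "even ((2 * m) choose Suc (2 * j))" for j by auto
    have "even ((2 * Suc m) choose (2 * j)) \<longleftrightarrow> even (Suc m choose j)" for j
      using IH[of j] IH[of "j - 1"] by (cases j) auto
    moreover have "even ((2 * Suc m) choose (2 * j + 1))" for j
      using IH[of j] IH[of "j - 1"] by (cases j) auto
    ultimately show ?case by blast
  qed
  then show "even ((2 * m) choose (2 * j)) \<longleftrightarrow> even (m choose j)"
    and "even ((2 * m) choose (2 * j + 1))" by blast+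
qed

text \<open>
  For \<open>n > 1\<close> the entry \<open>n choose 1\<close> forces \<open>n\<close> to be even, and the entries with even lower index reproduce
  the row of \<open>n div 2\<close>, so the argument descends.
\<close>
lemma power_of_two_if_inner_binomials_even:
  assumes "0 < n" and "\<And>j. 0 < j \<Longrightarrow> j < n \<Longrightarrow> even (n choose j)"
  shows "\<exists>l. n = 2 ^ l"
  using assms
proof (induction n rule: less_induct)
  case (less n)
  show ?case
  proof (cases "n = 1")
    case True
    then show ?thesis by (intro exI[of _ 0]) simp
  next
    case False
    then have "even n" using less.prems(2)[of 1] less.prems(1) by simp
    then obtain m where m: "n = 2 * m" by blast
    have "even (m choose j)" if "0 < j" "j < m" for j
      using less.prems(2)[of "2 * j"] that binomial_double_parity(1)[of m j] m by simp
    then obtain l where "m = 2 ^ l" using less.IH[of m] m less.prems(1) by auto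
    then show ?thesis using m by (intro exI[of _ "Suc l"]) simp
  qed
qed

section \<open>The ring of upper triangular matrices\<close>

lemma ut_ring_simps:
  "carrier (ut_ring ty n) = {A \<in> carrier_mat n n. upper_triangular A}"
  "x \<otimes>\<^bsub>ut_ring ty n\<^esub> y = x * y"
  "x \<oplus>\<^bsub>ut_ring ty n\<^esub> y = x + y"
  "\<one>\<^bsub>ut_ring ty n\<^esub> = 1\<^sub>m n"
  by (simp_all add: ut_ring_def ring_mat_simps)

lemma mult_mat_index_sum:
  assumes "A \<in> carrier_mat n n" "B \<in> carrier_mat n n" "i < n" "j < n"
  shows "(A * B) $$ (i, j) = (\<Sum>k<n. A $$ (i, k) * B $$ (k, j))"
  using assms by (auto simp: scalar_prod_def lessThan_atLeast0 intro!: sum.cong)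

lemma upper_triangular_mult_diagonal:
  fixes A B :: "'a::comm_ring_1 mat"
  assumes A: "A \<in> carrier_mat n n" "upper_triangular A"
    and B: "B \<in> carrier_mat n n" "upper_triangular B" and i: "i < n"
  shows "(A * B) $$ (i, i) = A $$ (i, i) * B $$ (i, i)"
proof -
  have "A $$ (i, k) * B $$ (k, i) = (if k = i then A $$ (i, i) * B $$ (i, i) else 0)"
    if "k < n" for k
    using A B i that upper_triangularD[OF A(2), of k i] upper_triangularD[OF B(2), of i k]
    by (cases k i rule: linorder_cases) auto
  then have "(\<Sum>k<n. A $$ (i, k) * B $$ (k, i)) =
      (\<Sum>k<n. if k = i then A $$ (i, i) * B $$ (i, i) else 0)"
    by (intro sum.cong) simp_all
  then show ?thesis
    unfolding mult_mat_index_sum[OF A(1) B(1) i i] using i by simp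
qed

section \<open>Unitriangular matrices in characteristic two\<close>

text \<open>
  Unitriangularity is the case \<open>d = 1\<close>, and \<open>d \<ge> n\<close> means \<open>A = 1\<close>.  Tracking \<open>d\<close> makes it possible
  to show directly that iterated squaring leads from the first to the second, without
  expanding powers of \<open>1 + B\<close> or treating nilpotency of \<open>B\<close> separately.
\<close>
definition one_below_band :: "nat \<Rightarrow> nat \<Rightarrow> 'a::comm_ring_1 mat \<Rightarrow> bool" where
  "one_below_band n d A \<longleftrightarrow> A \<in> carrier_mat n n \<and>
     (\<forall>i<n. \<forall>j<n. j < i + d \<longrightarrow> A $$ (i, j) = 1\<^sub>m n $$ (i, j))"

lemma one_below_band_1_iff:
  "one_below_band n 1 A \<longleftrightarrow>
     A \<in> carrier_mat n n \<and> upper_triangular A \<and> (\<forall>i<n. A $$ (i, i) = 1)"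
  by (auto simp: one_below_band_def upper_triangular_def less_Suc_eq_le le_less)

lemma one_below_band_imp_eq_one:
  assumes "one_below_band n d A" "n \<le> d"
  shows "A = 1\<^sub>m n"
  by (rule eq_matI) (use assms in \<open>auto simp: one_below_band_def\<close>)

text \<open>
  In characteristic two \<open>(1 + B)\<^sup>2 = 1 + B\<^sup>2\<close>, and multiplying two matrices that vanish below
  the \<open>d\<close>-th superdiagonal adds the offsets of their bands.
\<close>
lemma one_below_band_square:
  fixes A :: "'a::comm_ring_1 mat"
  assumes A: "one_below_band n d A" and char2: "(2::'a) = 0"
  shows "one_below_band n (2 * d) (A * A)"
proof -
  define B where "B = A - 1\<^sub>m n"
  have Ac: "A \<in> carrier_mat n n" using A by (simp add: one_below_band_def)
  then have Bc: "B \<in> carrier_mat n n" unfolding B_def by (intro minus_carrier_mat) simp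
  have AB: "A = 1\<^sub>m n + B"
    by (rule eq_matI) (use Ac in \<open>auto simp: B_def\<close>)
  have "A * A = 1\<^sub>m n * A + B * A"
    unfolding AB by (rule add_mult_distrib_mat[where nc = n]) (use Bc in auto)
  also have "B * A = B + B * B"
    unfolding AB by (subst mult_add_distrib_mat[where n = n and nr = n and nc = n]) (use Bc in auto)
  finally have "A * A = 1\<^sub>m n + (B + B) + B * B"
    unfolding AB by (auto intro!: eq_matI simp: algebra_simps) (use Bc in auto)
  moreover have "B + B = 0\<^sub>m n n"
    by (rule eq_matI) (use Bc in \<open>auto simp: char2 mult_2[symmetric]\<close>)
  ultimately have AA: "A * A = 1\<^sub>m n + B * B" using Bc by simp
  have zero: "B $$ (i, j) = 0" if "i < n" "j < n" "j < i + d" for i j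
    using A Ac that by (simp add: B_def one_below_band_def)
  have "(B * B) $$ (i, j) = 0" if ij: "i < n" "j < n" "j < i + 2 * d" for i j
  proof -
    have "B $$ (i, k) * B $$ (k, j) = 0" if "k < n" for k
      using zero[of i k] zero[of k j] ij that by (cases "k < i + d") auto
    then show ?thesis by (simp add: mult_mat_index_sum[OF Bc Bc ij(1,2)])
  qed
  then show ?thesis
    using Bc by (auto simp: AA one_below_band_def)
qed

lemma one_below_band_pow_two_power:
  fixes A :: "'a::comm_ring_1 mat"
  assumes A: "one_below_band n 1 A" and char2: "(2::'a) = 0"
  shows "one_below_band n (2 ^ k) (A [^]\<^bsub>ut_ring TYPE('a) n\<^esub> (2 ^ k :: nat))"
proof -
  interpret ring "ut_ring TYPE('a) n" by (rule ring_ut_ring)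
  have Ac: "A \<in> carrier (ut_ring TYPE('a) n)"
    using A by (simp add: one_below_band_1_iff[unfolded One_nat_def] ut_ring_simps)
  show ?thesis
  proof (induction k)
    case 0
    then show ?case using A Ac by simp
  next
    case (Suc k)
    have "A [^]\<^bsub>ut_ring TYPE('a) n\<^esub> (2 ^ Suc k :: nat) =
        A [^]\<^bsub>ut_ring TYPE('a) n\<^esub> (2 ^ k :: nat) * A [^]\<^bsub>ut_ring TYPE('a) n\<^esub> (2 ^ k :: nat)"
      using nat_pow_mult[OF Ac, of "2 ^ k" "2 ^ k"] by (simp add: ut_ring_simps mult_2)
    then show ?case using one_below_band_square[OF Suc char2] by simp
  qed
qed

lemma unitriangular_pow_two_power_eq_one:
  fixes A :: "'a::comm_ring_1 mat"
  assumes "one_below_band n 1 A" "(2::'a) = 0" "n \<le> 2 ^ k"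
  shows "A [^]\<^bsub>ut_ring TYPE('a) n\<^esub> (2 ^ k :: nat) = 1\<^sub>m n"
  using one_below_band_imp_eq_one[OF one_below_band_pow_two_power[OF assms(1,2)] assms(3)] .

text \<open>
  All positive powers of an idempotent agree with it, while high powers \<open>2 ^ k\<close> of a unitriangular
  matrix are trivial.
\<close>
lemma idempotent_unitriangular_eq_one:
  fixes e :: "'a::comm_ring_1 mat"
  assumes e: "one_below_band n 1 e" and idem: "e * e = e" and char2: "(2::'a) = 0"
  shows "e = 1\<^sub>m n"
proof -
  interpret ring "ut_ring TYPE('a) n" by (rule ring_ut_ring)
  have ec: "e \<in> carrier (ut_ring TYPE('a) n)"
    using e by (simp add: one_below_band_1_iff[unfolded One_nat_def] ut_ring_simps)
  have pow: "e [^]\<^bsub>ut_ring TYPE('a) n\<^esub> Suc k = e" for k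
    using ec by (induction k) (auto simp: idem ut_ring_simps)
  have "e [^]\<^bsub>ut_ring TYPE('a) n\<^esub> (2 ^ n :: nat) = e"
    using pow[of "2 ^ n - 1"] by simp
  moreover have "n \<le> 2 ^ n" by (rule less_imp_le) (rule less_exp)
  ultimately show ?thesis
    using unitriangular_pow_two_power_eq_one[OF e char2, of n] by simp
qed

section \<open>The unipotent Jordan block\<close>

definition one_plus_jordan :: "nat \<Rightarrow> 'a::comm_ring_1 mat" where
  "one_plus_jordan n = mat n n (\<lambda>(i, j). if j = i \<or> j = Suc i then 1 else 0)"

text \<open>
  Right multiplication by \<open>1 + J\<close> adds to each column its left neighbour, which on the first row is
  Pascal's rule.
\<close>
lemma first_row_pow_one_plus_jordan:
  assumes "j < n"
  shows "(one_plus_jordan n [^]\<^bsub>ut_ring TYPE('a::comm_ring_1) n\<^esub> (k::nat)) $$ (0, j)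
    = (of_nat (k choose j) :: 'a)"
  using assms
proof (induction k arbitrary: j)
  case 0
  then show ?case by (cases j) (simp_all add: ut_ring_simps)
next
  case (Suc k)
  interpret ring "ut_ring TYPE('a) n" by (rule ring_ut_ring)
  define U where "U = (one_plus_jordan n :: 'a mat)"
  define P where "P = U [^]\<^bsub>ut_ring TYPE('a) n\<^esub> k"
  have U: "U \<in> carrier (ut_ring TYPE('a) n)"
    by (auto simp: U_def one_plus_jordan_def ut_ring_simps upper_triangular_def)
  then have Uc: "U \<in> carrier_mat n n" by (simp add: ut_ring_simps)
  have Pc: "P \<in> carrier_mat n n"
    using nat_pow_closed[OF U, of k] by (simp add: P_def ut_ring_simps)
  have IH: "P $$ (0, i) = of_nat (k choose i)" if "i < n" for i
    using Suc.IH[OF that] by (simp add: P_def U_def)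
  have "(P * U) $$ (0, j) = (\<Sum>i<n. P $$ (0, i) * U $$ (i, j))"
    using Suc.prems by (intro mult_mat_index_sum[OF Pc Uc]) auto
  also have "\<dots> = (\<Sum>i<n. (if i = j then P $$ (0, i) else 0) +
      (if Suc i = j then P $$ (0, i) else 0))"
    using Suc.prems by (intro sum.cong) (auto simp: U_def one_plus_jordan_def)
  also have "\<dots> = of_nat (Suc k choose j)"
  proof (cases j)
    case 0
    then show ?thesis using Suc.prems IH by (simp add: sum.distrib)
  next
    case (Suc j')
    then show ?thesis using Suc.prems IH by (simp add: sum.distrib add.commute)
  qed
  finally show ?case by (simp add: P_def U_def ut_ring_simps)
qed

section \<open>Decompositions over the field with two elements\<close>

lemma of_nat_bit_eq_0_iff: "(of_nat k :: bit) = 0 \<longleftrightarrow> even k"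
  by (cases "even k") (auto elim!: evenE oddE)

lemma unit_ut_ring_bit_unitriangular:
  assumes "u \<in> Units (ut_ring TYPE(bit) n)"
  shows "one_below_band n 1 u"
proof -
  obtain v where u: "u \<in> carrier_mat n n" "upper_triangular u"
    and v: "v \<in> carrier_mat n n" "upper_triangular v" and uv: "u * v = 1\<^sub>m n"
    using assms by (auto simp: Units_def ut_ring_simps)
  have "u $$ (i, i) = 1" if "i < n" for i
    using upper_triangular_mult_diagonal[OF u v that] that
    by (cases "u $$ (i, i)") (simp_all add: uv)
  then show ?thesis using u by (simp only: one_below_band_1_iff) simp
qed

lemma almost_torsion_clean_ut_ring_two_power:
  assumes "n = 2 ^ l"
  shows "almost_torsion_clean n (ut_ring TYPE(bit) n)"
  unfolding almost_torsion_clean_def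
proof (intro conjI ballI)
  interpret ring "ut_ring TYPE(bit) n" by (rule ring_ut_ring)
  show n: "0 < n" using assms by simp
  show "\<one>\<^bsub>ut_ring TYPE(bit) n\<^esub> \<noteq> \<zero>\<^bsub>ut_ring TYPE(bit) n\<^esub>"
    by (rule ut_ring_one_neq_zero[OF n])
  fix r assume "r \<in> carrier (ut_ring TYPE(bit) n)"
  then have r: "r \<in> carrier_mat n n" "upper_triangular r" by (auto simp: ut_ring_simps)
  define e where "e = mat n n (\<lambda>(i, j). if i = j then 1 + r $$ (i, i) else 0)"
  define u where "u = r - e"
  have e: "e \<in> carrier (ut_ring TYPE(bit) n)"
    by (auto simp: e_def ut_ring_simps upper_triangular_def)
  have "upper_triangular u"
    using r by (auto simp: u_def e_def upper_triangular_def)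
  moreover have "u $$ (i, i) = 1" if "i < n" for i
    using r that by (cases "r $$ (i, i)") (auto simp: u_def e_def)
  ultimately have band: "one_below_band n 1 u"
    by (simp only: one_below_band_1_iff) (auto simp: u_def e_def intro!: minus_carrier_mat)
  then have u: "u \<in> carrier (ut_ring TYPE(bit) n)"
    by (simp only: one_below_band_1_iff ut_ring_simps) simp
  have pow: "u [^]\<^bsub>ut_ring TYPE(bit) n\<^esub> n = \<one>\<^bsub>ut_ring TYPE(bit) n\<^esub>"
    using unitriangular_pow_two_power_eq_one[OF band, of l] assms by (simp add: ut_ring_simps)
  \<comment> \<open>The inverse of \<open>u\<close> is \<open>u ^ (n - 1)\<close>.\<close>
  obtain k where k: "n = Suc k" using n gr0_implies_Suc by blast
  let ?v = "u [^]\<^bsub>ut_ring TYPE(bit) n\<^esub> k"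
  have "u \<otimes>\<^bsub>ut_ring TYPE(bit) n\<^esub> ?v = \<one>\<^bsub>ut_ring TYPE(bit) n\<^esub>"
    using pow nat_pow_Suc2[OF u, of k] by (simp only: k)
  moreover have "?v \<otimes>\<^bsub>ut_ring TYPE(bit) n\<^esub> u = \<one>\<^bsub>ut_ring TYPE(bit) n\<^esub>"
    using pow nat_pow_Suc[of u k] by (simp only: k)
  ultimately have "u \<in> Units (ut_ring TYPE(bit) n)"
    using u nat_pow_closed[OF u, of k] unfolding Units_def by blast
  moreover have "e \<otimes>\<^bsub>ut_ring TYPE(bit) n\<^esub> e = e"
  proof -
    have ec: "e \<in> carrier_mat n n" by (simp add: e_def)
    have "(e * e) $$ (i, j) = e $$ (i, j)" if ij: "i < n" "j < n" for i j
    proof -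
      have "(e * e) $$ (i, j) = (\<Sum>k<n. if k = i then e $$ (i, j) else 0)"
        unfolding mult_mat_index_sum[OF ec ec ij]
      proof (rule sum.cong)
        show "e $$ (i, k) * e $$ (k, j) = (if k = i then e $$ (i, j) else 0)"
          if "k \<in> {..<n}" for k
          using ij that by (cases "r $$ (i, i)") (auto simp: e_def)
      qed simp
      then show ?thesis using ij by simp
    qed
    then show ?thesis using ec by (auto simp: ut_ring_simps intro!: eq_matI)
  qed
  moreover have "r = u \<oplus>\<^bsub>ut_ring TYPE(bit) n\<^esub> e"
    by (simp add: ut_ring_simps, rule eq_matI)
      (use r in \<open>auto simp: u_def e_def simp del: add_bit_eq_xor\<close>)
  ultimately show "\<exists>u\<in>Units (ut_ring TYPE(bit) n). \<exists>e\<in>carrier (ut_ring TYPE(bit) n).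
      u [^]\<^bsub>ut_ring TYPE(bit) n\<^esub> n = \<one>\<^bsub>ut_ring TYPE(bit) n\<^esub> \<and>
      e \<otimes>\<^bsub>ut_ring TYPE(bit) n\<^esub> e = e \<and> r = u \<oplus>\<^bsub>ut_ring TYPE(bit) n\<^esub> e"
    using e pow by blast
qed (rule ring_ut_ring)

lemma two_power_if_almost_torsion_clean_ut_ring:
  assumes clean: "almost_torsion_clean n (ut_ring TYPE(bit) n)"
  shows "\<exists>l. n = 2 ^ l"
proof -
  have n: "0 < n" using clean by (simp add: almost_torsion_clean_def)
  define J where "J = mat n n (\<lambda>(i, j). if j = Suc i then 1 else 0 :: bit)"
  have "J \<in> carrier (ut_ring TYPE(bit) n)"
    by (auto simp: J_def ut_ring_simps upper_triangular_def)
  then obtain u e where u: "u \<in> Units (ut_ring TYPE(bit) n)"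
    and e: "e \<in> carrier_mat n n" "upper_triangular e" and idem: "e * e = e"
    and pow: "u [^]\<^bsub>ut_ring TYPE(bit) n\<^esub> n = 1\<^sub>m n" and J: "J = u + e"
    using clean unfolding almost_torsion_clean_def ut_ring_simps by blast
  have uni: "u \<in> carrier_mat n n" "\<forall>i<n. u $$ (i, i) = 1"
    using unit_ut_ring_bit_unitriangular[OF u] unfolding one_below_band_1_iff by blast+
  \<comment> \<open>The diagonal of \<open>J\<close> vanishes, so \<open>e\<close> has the same diagonal as \<open>u\<close>.\<close>
  have "e $$ (i, i) = 1" if "i < n" for i
  proof -
    have "u $$ (i, i) + e $$ (i, i) = J $$ (i, i)" using that uni e by (simp add: J)
    then show ?thesis using that uni by (cases "e $$ (i, i)") (auto simp: J_def)
  qed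
  then have "one_below_band n 1 e" using e by (simp only: one_below_band_1_iff) simp
  then have e1: "e = 1\<^sub>m n" by (rule idempotent_unitriangular_eq_one[OF _ idem]) simp
  have "u = one_plus_jordan n"
  proof (rule eq_matI)
    fix i j assume "i < dim_row (one_plus_jordan n :: bit mat)" "j < dim_col (one_plus_jordan n :: bit mat)"
    then have ij: "i < n" "j < n" by (simp_all add: one_plus_jordan_def)
    have "u $$ (i, j) + 1\<^sub>m n $$ (i, j) = J $$ (i, j)" using ij uni e by (simp add: J e1)
    then show "u $$ (i, j) = one_plus_jordan n $$ (i, j)"
      using ij by (cases "u $$ (i, j)") (auto simp: J_def one_plus_jordan_def split: if_splits)
  qed (use uni in \<open>simp_all add: one_plus_jordan_def\<close>)
  then have "(of_nat (n choose j) :: bit) = 1\<^sub>m n $$ (0, j)" if "j < n" for j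
    using first_row_pow_one_plus_jordan[OF that, where k = n and 'a = bit] pow by simp
  then have "even (n choose j)" if "0 < j" "j < n" for j
    using that n of_nat_bit_eq_0_iff[of "n choose j"] by simp
  then show ?thesis using power_of_two_if_inner_binomials_even[OF n] by blast
qed

theorem theorem2p11:
  fixes n :: nat
  assumes "n > 2"
  shows "almost_torsion_clean n (ut_ring TYPE(bit) n) \<longleftrightarrow> (\<exists>l::nat. l \<ge> 2 \<and> n = 2 ^ l)"
proof
  assume "almost_torsion_clean n (ut_ring TYPE(bit) n)"
  then obtain l where l: "n = 2 ^ l" using two_power_if_almost_torsion_clean_ut_ring by blast
  have "(2::nat) ^ 1 < 2 ^ l" using assms l by simp
  then have "1 < l" by (simp only: power_strict_increasing_iff one_less_numeral_iff semiring_norm)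
  then show "\<exists>l::nat. l \<ge> 2 \<and> n = 2 ^ l" using l by (intro exI[of _ l]) simp
next
  assume "\<exists>l::nat. l \<ge> 2 \<and> n = 2 ^ l"
  then show "almost_torsion_clean n (ut_ring TYPE(bit) n)"
    using almost_torsion_clean_ut_ring_two_power by blast
qed

end
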